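(* Let $M=(E,\mathcal{I})$ be a matroid with $E=\{1,\dots,n\}$, let $p\ge2$ and $l\ge1$ be integers, and let $(n_1,\dots,n_p)$ and $(m_1,\dots,m_p)$ be $p$-tuples of integers with $n_1+\cdots+n_p=m_1+\cdots+m_p=0$. Then \[f_{l+n_1}(M)f_{l+n_2}(M)\cdots f_{l+n_p}(M)\ \ge\ f_{l+m_1}(M)f_{l+m_2}(M)\cdots f_{l+m_p}(M)\] holds if and only if, for every integer $k\le l$ and every matroid of the form $N=M[\mathbf{X},\mathbf{q}]$ with $\mathbf{q}=(1,2,\dots,p-1)$ and $\mathbf{X}=(X_1,\dots,X_p)$ a $p$-tuple of pairwise disjoint subsets of $E$, such that $N$ has size $pk$ and depth $l-k$, we have \[\pi_{(k+n_1,\dots,k+n_p)}(N)\ge\pi_{(k+m_1,\dots,k+m_p)}(N).\]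
   Context: For $j\ge0$, $f_j(M)=\sum_{I\in\mathcal{I},|I|=j}\prod_{i\in I}x_i\in\mathbb{R}[x_1,\dots,x_n]$ (this is $0$ if $j$ exceeds the rank of $M$), and $f_j(M)=0$ for $j<0$. For polynomials, $F\ge G$ means $F-G$ has nonnegative coefficients. For a matroid $N$ with ground set $Y$ and an integer tuple $\mathbf{i}=(i_1,\dots,i_p)$, $\pi_{\mathbf{i}}(N)$ is the number of ordered set partitions $(A_1,\dots,A_p)$ of $Y$ (pairwise disjoint, union $Y$, blocks possibly empty) with each $A_s$ independent in $N$ and $|A_s|=i_s$ (so it is $0$ if some $i_s<0$ or $\sum i_s\neq|Y|$). For $X\subseteq E$ and a positive integer $q$, $M\odot X^{q}$ denotes the matroid obtained from $M$ by replacing each element $x\in X$ by $q$ elements $x=x^{(0)},x^{(1)},\dots,x^{(q-1)}$ in parallel. For disjoint $X_1,\dots,X_p\subseteq E$ and $\mathbf{q}=(q_1,\dots,q_{p-1})$ of positive integers, \[M[\mathbf{X},\mathbf{q}]=\big(M(X_1\cup\cdots\cup X_p)\odot X_1^{q_1}\cdots\odot X_{p-1}^{q_{p-1}}\big)/X_p,\] where $M(T)$ is the restriction of $M$ to $T$ and $/X_p$ denotes contraction of $X_p$. Its size is the cardinality of its ground set (here $|X_1|+2|X_2|+\cdots+(p-1)|X_{p-1}|$ when $\mathbf{q}=(1,\dots,p-1)$), and its depth is the rank of $X_p$ in $M$. *)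

theory Defs
  imports
    Complex_Main
    "HOL-Library.Poly_Mapping"
    "HOL-Library.FuncSet"
    "HOL-Library.Disjoint_Sets"
begin

section \<open>Finite matroids\<close>

record 'a matroid =
  ground :: "'a set"
  indeps :: "'a set set"

definition is_matroid :: "'a matroid \<Rightarrow> bool" where
  "is_matroid M \<longleftrightarrow>
     finite (ground M) \<and>
     (\<forall>I \<in> indeps M. I \<subseteq> ground M) \<and>
     {} \<in> indeps M \<and>
     (\<forall>J \<in> indeps M. \<forall>I. I \<subseteq> J \<longrightarrow> I \<in> indeps M) \<and>
     (\<forall>I \<in> indeps M. \<forall>J \<in> indeps M. card I < card J \<longrightarrow>
        (\<exists>x \<in> J - I. insert x I \<in> indeps M))"

definition mrank :: "'a matroid \<Rightarrow> 'a set \<Rightarrow> nat" where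
  "mrank M T = Max (card ` {I \<in> indeps M. I \<subseteq> T})"

definition basis_of :: "'a matroid \<Rightarrow> 'a set \<Rightarrow> 'a set \<Rightarrow> bool" where
  "basis_of M T B \<longleftrightarrow>
     B \<in> indeps M \<and> B \<subseteq> T \<and> (\<forall>C \<in> indeps M. B \<subseteq> C \<and> C \<subseteq> T \<longrightarrow> C = B)"

definition restriction :: "'a matroid \<Rightarrow> 'a set \<Rightarrow> 'a matroid" where
  "restriction M T = \<lparr>ground = ground M \<inter> T, indeps = {I \<in> indeps M. I \<subseteq> T}\<rparr>"

definition contraction :: "'a matroid \<Rightarrow> 'a set \<Rightarrow> 'a matroid" where
  "contraction M T =
     \<lparr>ground = ground M - T,
      indeps = {J. J \<subseteq> ground M - T \<and> (\<exists>B. basis_of M T B \<and> J \<union> B \<in> indeps M)}\<rparr>"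

section \<open>Replacing elements by parallel copies\<close>

text \<open>The pair \<open>(x, i)\<close> stands for the copy \<open>x\<^sup>i\<close> of the element \<open>x\<close>, and \<open>(x, 0)\<close>
  is \<open>x\<close> itself; \<open>with_copies\<close> makes this identification.\<close>

definition with_copies :: "'a matroid \<Rightarrow> ('a \<times> nat) matroid" where
  "with_copies M =
     \<lparr>ground = (\<lambda>x. (x, 0)) ` ground M, indeps = (\<lambda>I. (\<lambda>x. (x, 0)) ` I) ` indeps M\<rparr>"

definition collapse :: "'a set \<Rightarrow> 'a \<times> nat \<Rightarrow> 'a \<times> nat" where
  "collapse X y = (if fst y \<in> X then (fst y, 0) else y)"

text \<open>\<open>par_ext N X q\<close> replaces every \<open>(x, 0)\<close> with \<open>x \<in> X\<close> by \<open>q\<close> parallel elements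
  \<open>(x, 0), \<dots>, (x, q - 1)\<close>: a set is independent iff it contains at most one copy of each
  \<open>x \<in> X\<close> and becomes independent in \<open>N\<close> when every copy is replaced by its original. It is
  meant for \<open>X \<times> {0} \<subseteq> ground N\<close> and \<open>q \<ge> 1\<close>, with no \<open>x \<in> X\<close> having further copies
  in \<open>N\<close>.\<close>

definition par_ext :: "('a \<times> nat) matroid \<Rightarrow> 'a set \<Rightarrow> nat \<Rightarrow> ('a \<times> nat) matroid" where
  "par_ext N X q =
     (let Y = {y \<in> ground N. fst y \<notin> X} \<union> X \<times> {..<q}
      in \<lparr>ground = Y,
          indeps = {J. J \<subseteq> Y \<and> inj_on (collapse X) J \<and> collapse X ` J \<in> indeps N}\<rparr>)"

text \<open>Here and below a \<open>p\<close>-tuple is a function on \<open>nat\<close> of which only the values at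
  \<open>1, \<dots>, p\<close> matter; \<open>q\<close> is used at \<open>1, \<dots>, p - 1\<close>, which is what the list \<open>[1..<p]\<close>
  enumerates.\<close>

definition minor_Xq ::
  "'a matroid \<Rightarrow> nat \<Rightarrow> (nat \<Rightarrow> 'a set) \<Rightarrow> (nat \<Rightarrow> nat) \<Rightarrow> ('a \<times> nat) matroid" where
  "minor_Xq M p X q =
     contraction
       (foldl (\<lambda>N s. par_ext N (X s) (q s))
          (with_copies (restriction M (\<Union>s\<in>{1..p}. X s))) [1..<p])
       (X p \<times> {0})"

section \<open>Ordered partitions into independent sets\<close>

definition ordered_indep_partitions ::
  "'a matroid \<Rightarrow> nat \<Rightarrow> (nat \<Rightarrow> int) \<Rightarrow> (nat \<Rightarrow> 'a set) set" where
  "ordered_indep_partitions N p i =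
     {A \<in> {1..p} \<rightarrow>\<^sub>E indeps N.
        disjoint_family_on A {1..p} \<and> (\<Union>s\<in>{1..p}. A s) = ground N \<and>
        (\<forall>s\<in>{1..p}. int (card (A s)) = i s)}"

definition num_partitions :: "'a matroid \<Rightarrow> nat \<Rightarrow> (nat \<Rightarrow> int) \<Rightarrow> nat" where
  "num_partitions N p i = card (ordered_indep_partitions N p i)"

section \<open>Independent set polynomials\<close>

text \<open>A monomial is a finitely supported exponent vector, so real polynomials in variables
  indexed by \<open>'a\<close> form the ring \<open>('a \<Rightarrow>\<^sub>0 nat) \<Rightarrow>\<^sub>0 real\<close>. Only variables \<open>x\<^sub>i\<close> with
  \<open>i \<in> ground M\<close> occur in \<open>indep_poly M j\<close>.\<close>

definition mvar :: "'a \<Rightarrow> ('a \<Rightarrow>\<^sub>0 nat) \<Rightarrow>\<^sub>0 real" where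
  "mvar i = Poly_Mapping.single (Poly_Mapping.single i 1) 1"

definition indep_poly :: "'a matroid \<Rightarrow> int \<Rightarrow> ('a \<Rightarrow>\<^sub>0 nat) \<Rightarrow>\<^sub>0 real" where
  "indep_poly M j = (\<Sum>I | I \<in> indeps M \<and> int (card I) = j. \<Prod>i\<in>I. mvar i)"

text \<open>This is not the order \<open>\<ge>\<close> that the library puts on \<open>\<Rightarrow>\<^sub>0\<close>, which is lexicographic.\<close>

definition coeff_ge ::
  "(('a \<Rightarrow>\<^sub>0 nat) \<Rightarrow>\<^sub>0 real) \<Rightarrow> (('a \<Rightarrow>\<^sub>0 nat) \<Rightarrow>\<^sub>0 real) \<Rightarrow> bool"  (infix \<open>\<succeq>\<^sub>c\<close> 50) where
  "F \<succeq>\<^sub>c G \<longleftrightarrow> (\<forall>m. Poly_Mapping.lookup (F - G) m \<ge> 0)"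

section \<open>The constructions yield matroids\<close>

lemma is_matroidD:
  assumes "is_matroid M"
  shows "finite (ground M)" "I \<in> indeps M \<Longrightarrow> I \<subseteq> ground M" "{} \<in> indeps M"
    "J \<in> indeps M \<Longrightarrow> I \<subseteq> J \<Longrightarrow> I \<in> indeps M"
    "I \<in> indeps M \<Longrightarrow> J \<in> indeps M \<Longrightarrow> card I < card J \<Longrightarrow> \<exists>x \<in> J - I. insert x I \<in> indeps M"
    "I \<in> indeps M \<Longrightarrow> finite I"
proof -
  show "I \<in> indeps M \<Longrightarrow> finite I"
    using assms unfolding is_matroid_def by (meson finite_subset)
qed (use assms in \<open>unfold is_matroid_def, blast+\<close>)

lemma is_matroid_restriction:
  assumes "is_matroid M"
  shows "is_matroid (restriction M T)"
proof -
  note D = is_matroidD[OF assms]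
  show ?thesis
    unfolding is_matroid_def restriction_def
  proof (simp only: matroid.simps, intro conjI ballI allI impI)
    fix I J assume "I \<in> {I \<in> indeps M. I \<subseteq> T}" "J \<in> {I \<in> indeps M. I \<subseteq> T}" "card I < card J"
    with D(5)[of I J] show "\<exists>x\<in>J - I. insert x I \<in> {I \<in> indeps M. I \<subseteq> T}"
      by blast
  qed (use D in auto)
qed

lemma is_matroid_pullback:
  assumes "is_matroid N" "finite Y"
  shows "is_matroid \<lparr>ground = Y, indeps = {J. J \<subseteq> Y \<and> inj_on c J \<and> c ` J \<in> indeps N}\<rparr>"
proof -
  note D = is_matroidD[OF assms(1)]
  show ?thesis
    unfolding is_matroid_def
  proof (simp only: matroid.simps, intro conjI ballI allI impI)
    fix I J assume I: "I \<in> {J. J \<subseteq> Y \<and> inj_on c J \<and> c ` J \<in> indeps N}"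
      and J: "J \<in> {J. J \<subseteq> Y \<and> inj_on c J \<and> c ` J \<in> indeps N}" and lt: "card I < card J"
    have "card (c ` I) < card (c ` J)"
      using I J lt by (simp add: card_image)
    then obtain z where z: "z \<in> c ` J - c ` I" "insert z (c ` I) \<in> indeps N"
      using D(5)[of "c ` I" "c ` J"] I J by blast
    then obtain y where "y \<in> J" "z = c y" by blast
    then show "\<exists>x\<in>J - I. insert x I \<in> {J. J \<subseteq> Y \<and> inj_on c J \<and> c ` J \<in> indeps N}"
      using z I J by (intro bexI[of _ y]) auto
  next
    fix I J assume J: "J \<in> {J. J \<subseteq> Y \<and> inj_on c J \<and> c ` J \<in> indeps N}" and s: "I \<subseteq> J"
    have "c ` I \<in> indeps N" using D(4)[of "c ` J" "c ` I"] J s by blast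
    then show "I \<in> {J. J \<subseteq> Y \<and> inj_on c J \<and> c ` J \<in> indeps N}"
      using J s inj_on_subset[of c J I] by blast
  qed (use assms(2) D in auto)
qed

lemma is_matroid_par_ext:
  assumes "is_matroid N" "finite X"
  shows "is_matroid (par_ext N X q)"
  unfolding par_ext_def Let_def
  by (rule is_matroid_pullback) (use assms is_matroidD(1)[OF assms(1)] in auto)

lemma is_matroid_with_copies:
  assumes "is_matroid M"
  shows "is_matroid (with_copies M)"
proof -
  note D = is_matroidD[OF assms]
  have "with_copies M = \<lparr>ground = (\<lambda>x. (x, 0)) ` ground M, indeps =
      {J. J \<subseteq> (\<lambda>x. (x, 0)) ` ground M \<and> inj_on fst J \<and> fst ` J \<in> indeps M}\<rparr>"
  proof -
    have "J \<in> (\<lambda>I. (\<lambda>x. (x, 0)) ` I) ` indeps M \<longleftrightarrow>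
        J \<subseteq> (\<lambda>x. (x, 0::nat)) ` ground M \<and> inj_on fst J \<and> fst ` J \<in> indeps M" for J
    proof
      assume "J \<in> (\<lambda>I. (\<lambda>x. (x, 0)) ` I) ` indeps M"
      then obtain I where I: "I \<in> indeps M" "J = (\<lambda>x. (x, 0)) ` I" by blast
      then show "J \<subseteq> (\<lambda>x. (x, 0::nat)) ` ground M \<and> inj_on fst J \<and> fst ` J \<in> indeps M"
        using D(2)[OF I(1)] by (auto simp: inj_on_def image_image)
    next
      assume J: "J \<subseteq> (\<lambda>x. (x, 0::nat)) ` ground M \<and> inj_on fst J \<and> fst ` J \<in> indeps M"
      then have "J = (\<lambda>x. (x, 0)) ` (fst ` J)" by force
      then show "J \<in> (\<lambda>I. (\<lambda>x. (x, 0)) ` I) ` indeps M" using J by blast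
    qed
    then have "(\<lambda>I. (\<lambda>x. (x, 0)) ` I) ` indeps M =
        {J. J \<subseteq> (\<lambda>x. (x, 0::nat)) ` ground M \<and> inj_on fst J \<and> fst ` J \<in> indeps M}"
      by blast
    then show ?thesis unfolding with_copies_def by simp
  qed
  then show ?thesis using is_matroid_pullback[OF assms, of "(\<lambda>x. (x, 0)) ` ground M" fst] D(1)
    by simp
qed

lemma indep_extend:
  assumes M: "is_matroid M" and "I \<in> indeps M" "J \<in> indeps M" "card I \<le> card J"
  shows "\<exists>K. K \<subseteq> J - I \<and> I \<union> K \<in> indeps M \<and> card (I \<union> K) = card J"
  using assms(2-)
proof (induction "card J - card I" arbitrary: I)
  case 0
  then show ?case by (intro exI[of _ "{}"]) auto
next
  case (Suc d)
  note D = is_matroidD[OF M]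
  obtain x where x: "x \<in> J - I" "insert x I \<in> indeps M"
    using D(5)[of I J] Suc.prems Suc.hyps(2) by (metis zero_less_Suc zero_less_diff)
  have "card (insert x I) = Suc (card I)" using x D(6) Suc.prems by simp
  moreover have "d = card J - card (insert x I)" "card (insert x I) \<le> card J"
    using calculation Suc.hyps(2) by linarith+
  ultimately obtain K
    where "K \<subseteq> J - insert x I" "insert x I \<union> K \<in> indeps M" "card (insert x I \<union> K) = card J"
    using Suc.hyps(1)[of "insert x I"] x(2) Suc.prems(2) by blast
  with x show ?case by (intro exI[of _ "insert x K"]) auto
qed

lemma basis_card_le:
  assumes M: "is_matroid M" and B: "basis_of M T B" and I: "I \<in> indeps M" "I \<subseteq> T"
  shows "card I \<le> card B"
proof (rule ccontr)
  assume "\<not> ?thesis"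
  then obtain x where "x \<in> I - B" "insert x B \<in> indeps M"
    using is_matroidD(5)[OF M, of B I] B I unfolding basis_of_def by auto
  then show False using B I unfolding basis_of_def by blast
qed

lemma ex_basis_of:
  assumes M: "is_matroid M"
  shows "\<exists>B. basis_of M T B"
proof -
  note D = is_matroidD[OF M]
  let ?S = "{I \<in> indeps M. I \<subseteq> T}"
  have "?S \<subseteq> Pow (ground M)" using D(2) by blast
  then have fin: "finite ?S" using D(1) by (simp add: finite_subset)
  have "?S \<noteq> {}" using D(3) by blast
  with finite_has_maximal[OF fin] obtain B where "B \<in> ?S" "\<forall>C\<in>?S. B \<subseteq> C \<longrightarrow> B = C" by auto
  then show ?thesis unfolding basis_of_def by blast
qed

lemma contraction_basis_indep:
  assumes M: "is_matroid M" and B: "basis_of M T B" and C: "basis_of M T C"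
    and J: "J \<inter> T = {}" "J \<union> B \<in> indeps M"
  shows "J \<union> C \<in> indeps M"
proof -
  note D = is_matroidD[OF M]
  have BC: "B \<in> indeps M" "C \<in> indeps M" "B \<subseteq> T" "C \<subseteq> T"
    using B C unfolding basis_of_def by auto
  have eq: "card B = card C"
    using basis_card_le[OF M B] basis_card_le[OF M C] BC by (meson le_antisym)
  have fJ: "finite J" "finite B" "finite C" using D(6)[OF J(2)] D(6)[OF BC(2)] by auto
  have cJ: "card (J \<union> B) = card J + card B"
    using fJ J(1) BC by (intro card_Un_disjoint) auto
  obtain K where K: "K \<subseteq> (J \<union> B) - C" "C \<union> K \<in> indeps M" "card (C \<union> K) = card (J \<union> B)"
    using indep_extend[OF M BC(2) J(2)] cJ eq by auto
  have "K \<inter> T = {}"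
  proof (rule ccontr)
    assume "K \<inter> T \<noteq> {}"
    then obtain x where x: "x \<in> K" "x \<in> T" by blast
    have "insert x C \<in> indeps M" using D(4)[OF K(2)] x by blast
    then show False using C x K(1) BC unfolding basis_of_def by blast
  qed
  then have KJ: "K \<subseteq> J" using K(1) BC by blast
  have "card (C \<union> K) = card C + card K"
    using fJ KJ K(1) finite_subset[OF KJ] by (intro card_Un_disjoint) auto
  then have "card K = card J" using K(3) cJ eq by simp
  then have "K = J" using KJ fJ by (simp add: card_subset_eq)
  then show ?thesis using K(2) by (simp add: Un_commute)
qed

lemma is_matroid_contraction:
  assumes M: "is_matroid M"
  shows "is_matroid (contraction M T)"
proof -
  note D = is_matroidD[OF M]
  obtain B where B: "basis_of M T B" using ex_basis_of[OF M] by blast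
  have BM: "B \<in> indeps M" "B \<subseteq> T" using B unfolding basis_of_def by auto
  have eq: "contraction M T =
      \<lparr>ground = ground M - T, indeps = {J. J \<subseteq> ground M - T \<and> J \<union> B \<in> indeps M}\<rparr>"
  proof -
    have "(\<exists>C. basis_of M T C \<and> J \<union> C \<in> indeps M) \<longleftrightarrow> J \<union> B \<in> indeps M"
      if "J \<subseteq> ground M - T" for J
      using contraction_basis_indep[OF M _ B, of _ J] B that by blast
    then show ?thesis unfolding contraction_def by auto
  qed
  show ?thesis
    unfolding eq is_matroid_def
  proof (simp only: matroid.simps, intro conjI ballI allI impI)
    fix I J assume I: "I \<in> {J. J \<subseteq> ground M - T \<and> J \<union> B \<in> indeps M}"
      and J: "J \<in> {J. J \<subseteq> ground M - T \<and> J \<union> B \<in> indeps M}" and lt: "card I < card J"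
    have fin: "finite I" "finite J" "finite B" using I J D(6) by auto
    have "card (I \<union> B) < card (J \<union> B)"
      using fin I J BM lt by (subst (1 2) card_Un_disjoint) auto
    then obtain x where "x \<in> (J \<union> B) - (I \<union> B)" "insert x (I \<union> B) \<in> indeps M"
      using D(5)[of "I \<union> B" "J \<union> B"] I J by blast
    then show "\<exists>x\<in>J - I. insert x I \<in> {J. J \<subseteq> ground M - T \<and> J \<union> B \<in> indeps M}"
      using I J by (intro bexI[of _ x]) auto
  next
    fix I J assume J: "J \<in> {J. J \<subseteq> ground M - T \<and> J \<union> B \<in> indeps M}" and s: "I \<subseteq> J"
    have "I \<union> B \<in> indeps M" using D(4)[of "J \<union> B" "I \<union> B"] J s by blast
    then show "I \<in> {J. J \<subseteq> ground M - T \<and> J \<union> B \<in> indeps M}" using J s by blast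
  qed (use D BM in auto)
qed

lemma is_matroid_minor_Xq:
  assumes "is_matroid M" "\<And>s. s \<in> {1..p} \<Longrightarrow> X s \<subseteq> ground M"
  shows "is_matroid (minor_Xq M p X q)"
proof -
  have fin: "finite (X s)" if "s \<in> {1..p}" for s
    using assms is_matroidD(1) finite_subset that by metis
  have "is_matroid (foldl (\<lambda>N s. par_ext N (X s) (q s)) N ss)"
    if "is_matroid N" "set ss \<subseteq> {1..p}" for N ss
    using that
  proof (induction ss arbitrary: N)
    case (Cons s ss)
    then show ?case using is_matroid_par_ext[OF _ fin] by auto
  qed simp
  from this[OF is_matroid_with_copies[OF is_matroid_restriction[OF assms(1)]]]
  have "is_matroid (foldl (\<lambda>N s. par_ext N (X s) (q s))
      (with_copies (restriction M (\<Union>s\<in>{1..p}. X s))) [1..<p])"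
    by (simp add: subset_iff)
  then show ?thesis
    unfolding minor_Xq_def by (rule is_matroid_contraction)
qed

end

theory Submission
  imports Defs
begin

text \<open>
  The coefficient of a monomial \<open>x\<^sup>e\<close> in \<open>f\<^bsub>l + n\<^sub>1\<^esub> \<cdots> f\<^bsub>l + n\<^sub>p\<^esub>\<close> counts the tuples of independent
  sets of sizes \<open>l + n\<^sub>s\<close> that cover each element \<open>x\<close> exactly \<open>e x\<close> times. Put
  \<open>X\<^sub>s = {x. e x = s}\<close>. Elements of \<open>X\<^sub>p\<close> lie in every member of the tuple, so removing them gives
  tuples of independent sets of \<open>M / X\<^sub>p\<close>. An ordered partition of \<open>M[X, (1, \<dots>, p - 1)]\<close> into
  independent sets is such a tuple together with, for each \<open>x\<close>, a bijection between the members
  containing \<open>x\<close> and the \<open>e x\<close> copies of \<open>x\<close>. Hence the partition number is the coefficient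
  times \<open>\<Prod>\<^sub>x (e x)!\<close>, a positive factor that does not depend on the \<open>n\<^sub>s\<close>. For a dependent
  \<open>X\<^sub>p\<close> the same holds with the exponent \<open>p\<close> placed on a basis of \<open>X\<^sub>p\<close> only.
\<close>

section \<open>Counting injections, parallel copies, and families with prescribed
  multiplicities\<close>

text \<open>Between sets of equal finite size, injections are bijections, hence the factorial. This
  counts the ways to hand out the copies of one element to the blocks that are to contain
  it.\<close>

lemma card_inj_funcset:
  assumes "finite S" "finite T" "card S = card T"
  shows "card {f \<in> S \<rightarrow>\<^sub>E T. inj_on f S} = fact (card T)"
  using card_inj_on_subset_funcset[OF assms(1,2) subset_refl] assms(3)
  by (simp add: fact_prod_rev atLeast0LessThan)

text \<open>One closed form for everything built before the contraction: each \<open>x\<close>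
  becomes a parallel class of size \<open>g x\<close>, and \<open>g x = 0\<close> deletes
  \<open>x\<close>. Restriction and each \<open>par_ext\<close> then only change
  \<open>g\<close>.\<close>

definition copies :: "'a matroid \<Rightarrow> ('a \<Rightarrow> nat) \<Rightarrow> ('a \<times> nat) matroid" where
  "copies M g =
     \<lparr>ground = (SIGMA x:ground M. {..<g x}),
      indeps = {J. J \<subseteq> (SIGMA x:ground M. {..<g x}) \<and> inj_on fst J \<and> fst ` J \<in> indeps M}\<rparr>"

text \<open>These are the tuples counted by the coefficient at the exponent vector \<open>g\<close>.
  The condition on \<open>g\<close> ranges over all \<open>x\<close>, so for
  \<open>p \<ge> 1\<close> an exponent outside the ground set leaves no tuples of independent
  sets.\<close>

definition multifamilies ::
  "'a matroid \<Rightarrow> nat \<Rightarrow> (nat \<Rightarrow> int) \<Rightarrow> ('a \<Rightarrow> nat) \<Rightarrow> (nat \<Rightarrow> 'a set) set" where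
  "multifamilies M p i g =
     {D \<in> {1..p} \<rightarrow>\<^sub>E indeps M.
        (\<forall>s\<in>{1..p}. int (card (D s)) = i s) \<and> (\<forall>x. card {s \<in> {1..p}. x \<in> D s} = g x)}"

lemma finite_indeps: "is_matroid M \<Longrightarrow> finite (indeps M)"
  using is_matroidD(1,2)[of M] by (meson PowI finite_Pow_iff finite_subset subsetI)

lemma finite_multifamilies: "is_matroid M \<Longrightarrow> finite (multifamilies M p i g)"
  unfolding multifamilies_def by (simp add: finite_PiE finite_indeps)

lemma copies_cong:
  assumes "\<And>x. x \<in> ground M \<Longrightarrow> g x = h x"
  shows "copies M g = copies M h"
proof -
  have "(SIGMA x:ground M. {..<g x}) = (SIGMA x:ground M. {..<h x})"
    using assms by auto
  then show ?thesis unfolding copies_def by simp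
qed

section \<open>Coefficients of products of independent set polynomials\<close>

text \<open>Expanding the product chooses one independent set per factor. The chosen monomials
  multiply to the one whose exponent vector is the sum of the indicator vectors
  \<open>?e (D s)\<close>, and its value at \<open>x\<close> is the number of chosen sets containing
  \<open>x\<close>.\<close>

lemma lookup_prod_indep_poly:
  assumes M: "is_matroid M"
  shows "Poly_Mapping.lookup (\<Prod>s=1..p. indep_poly M (j s)) m =
    real (card (multifamilies M p j (Poly_Mapping.lookup m)))"
proof -
  let ?e = "\<lambda>I. \<Sum>i\<in>I. Poly_Mapping.single i (1::nat)"
  let ?I = "\<lambda>s. {I \<in> indeps M. int (card I) = j s}"
  have mono: "(\<Prod>i\<in>I. mvar i) = Poly_Mapping.single (?e I) 1" for I :: "'a set"
    by (induction I rule: infinite_finite_induct) (simp_all add: mvar_def mult_single)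
  have prodmono: "(\<Prod>s\<in>S. Poly_Mapping.single (f s) (1::real)) = Poly_Mapping.single (\<Sum>s\<in>S. f s) 1"
    for S :: "nat set" and f :: "nat \<Rightarrow> 'a \<Rightarrow>\<^sub>0 nat"
    by (induction S rule: infinite_finite_induct) (simp_all add: mult_single)
  have fin: "finite (?I s)" for s
    using finite_indeps[OF M] by simp
  have "(\<Prod>s=1..p. indep_poly M (j s)) =
      (\<Sum>D\<in>Pi\<^sub>E {1..p} ?I. Poly_Mapping.single (\<Sum>s=1..p. ?e (D s)) 1)"
    unfolding indep_poly_def mono by (subst prod_sum_PiE) (simp_all add: fin prodmono)
  then have "Poly_Mapping.lookup (\<Prod>s=1..p. indep_poly M (j s)) m =
      (\<Sum>D\<in>Pi\<^sub>E {1..p} ?I. if (\<Sum>s=1..p. ?e (D s)) = m then 1 else 0)"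
    by (simp add: lookup_sum lookup_single when_def)
  also have "\<dots> = real (card {D \<in> Pi\<^sub>E {1..p} ?I. (\<Sum>s=1..p. ?e (D s)) = m})"
    by (subst sum.inter_filter[symmetric]) (simp_all add: finite_PiE fin)
  also have "{D \<in> Pi\<^sub>E {1..p} ?I. (\<Sum>s=1..p. ?e (D s)) = m} =
      multifamilies M p j (Poly_Mapping.lookup m)"
  proof -
    have "(\<Sum>s=1..p. ?e (D s)) = m \<longleftrightarrow>
        (\<forall>x. card {s \<in> {1..p}. x \<in> D s} = Poly_Mapping.lookup m x)"
      if "D \<in> Pi\<^sub>E {1..p} ?I" for D
    proof -
      have "Poly_Mapping.lookup (\<Sum>s=1..p. ?e (D s)) x = card {s \<in> {1..p}. x \<in> D s}" for x
      proof -
        have "Poly_Mapping.lookup (?e (D s)) x = (if x \<in> D s then 1 else 0)" if "s \<in> {1..p}" for s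
        proof -
          have "finite (D s)"
            using is_matroidD(6)[OF M] that \<open>D \<in> Pi\<^sub>E {1..p} ?I\<close> by (auto simp: PiE_iff)
          then show ?thesis
            by (simp add: lookup_sum lookup_single when_def)
        qed
        then have "Poly_Mapping.lookup (\<Sum>s=1..p. ?e (D s)) x = (\<Sum>s=1..p. if x \<in> D s then 1 else 0)"
          by (simp add: lookup_sum)
        also have "\<dots> = card {s \<in> {1..p}. x \<in> D s}"
          by (subst sum.inter_filter[symmetric]) simp_all
        finally show ?thesis .
      qed
      then show ?thesis by (simp add: poly_mapping_eq_iff fun_eq_iff)
    qed
    then show ?thesis unfolding multifamilies_def by (auto simp: PiE_iff)
  qed
  finally show ?thesis .
qed

section \<open>Parallel extension, restriction and contraction in terms of multiplicities\<close>

text \<open>\<open>collapse X\<close> keeps first components, so injectivity of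
  \<open>collapse X\<close> on \<open>J\<close> and of \<open>fst\<close> on the image together
  amount to injectivity of \<open>fst\<close> on \<open>J\<close>. Positivity of \<open>g\<close> on
  \<open>X\<close> ensures that the original \<open>(x, 0)\<close> onto which copies collapse lies
  in the old ground set.\<close>

lemma par_ext_copies:
  assumes "X \<subseteq> ground M" "\<And>x. x \<in> X \<Longrightarrow> g x > 0"
  shows "par_ext (copies M g) X q = copies M (\<lambda>x. if x \<in> X then q else g x)"
proof -
  let ?Y = "SIGMA x:ground M. {..<if x \<in> X then q else g x}"
  have Y: "{y \<in> ground (copies M g). fst y \<notin> X} \<union> X \<times> {..<q} = ?Y"
    using assms(1) by (auto simp: copies_def split: if_splits)
  have fst_collapse: "fst (collapse X y) = fst y" for y :: "'a \<times> nat"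
    by (simp add: collapse_def)
  have "inj_on (collapse X) J \<and> collapse X ` J \<in> indeps (copies M g) \<longleftrightarrow>
      inj_on fst J \<and> fst ` J \<in> indeps M" if J: "J \<subseteq> ?Y" for J
  proof -
    have sub: "collapse X ` J \<subseteq> (SIGMA x:ground M. {..<g x})"
      using J assms by (fastforce simp: collapse_def split: if_splits)
    have img: "fst ` collapse X ` J = fst ` J"
      by (simp add: image_image fst_collapse)
    have "inj_on (collapse X) J \<and> inj_on fst (collapse X ` J) \<longleftrightarrow> inj_on (fst \<circ> collapse X) J"
      by (meson comp_inj_on_iff inj_on_imageI2)
    also have "\<dots> \<longleftrightarrow> inj_on fst J"
      by (simp add: inj_on_def fst_collapse)
    finally show ?thesis using sub img by (auto simp: copies_def)
  qed
  then show ?thesis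
    unfolding par_ext_def Let_def Y by (auto simp: copies_def)
qed

lemma with_copies_restriction:
  assumes M: "is_matroid M"
  shows "with_copies (restriction M U) = copies M (\<lambda>x. if x \<in> U then 1 else 0)"
proof -
  let ?Y = "SIGMA x:ground M. {..<if x \<in> U then 1 else 0::nat}"
  have Y: "?Y = (\<lambda>x. (x, 0)) ` (ground M \<inter> U)"
    by (auto split: if_splits)
  have "J \<in> (\<lambda>I. (\<lambda>x. (x, 0::nat)) ` I) ` {I \<in> indeps M. I \<subseteq> U} \<longleftrightarrow>
      J \<subseteq> ?Y \<and> inj_on fst J \<and> fst ` J \<in> indeps M" for J
  proof
    assume "J \<in> (\<lambda>I. (\<lambda>x. (x, 0)) ` I) ` {I \<in> indeps M. I \<subseteq> U}"
    then obtain I where I: "I \<in> indeps M" "I \<subseteq> U" "J = (\<lambda>x. (x, 0)) ` I" by blast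
    then show "J \<subseteq> ?Y \<and> inj_on fst J \<and> fst ` J \<in> indeps M"
      using is_matroidD(2)[OF M I(1)] by (auto simp: inj_on_def image_image)
  next
    assume J: "J \<subseteq> ?Y \<and> inj_on fst J \<and> fst ` J \<in> indeps M"
    then have "J = (\<lambda>x. (x, 0)) ` (fst ` J)" "fst ` J \<subseteq> U" unfolding Y by force+
    with J show "J \<in> (\<lambda>I. (\<lambda>x. (x, 0)) ` I) ` {I \<in> indeps M. I \<subseteq> U}" by blast
  qed
  then have "(\<lambda>I. (\<lambda>x. (x, 0::nat)) ` I) ` {I \<in> indeps M. I \<subseteq> U} =
      {J. J \<subseteq> ?Y \<and> inj_on fst J \<and> fst ` J \<in> indeps M}"
    by (intro set_eqI) (simp only: mem_Collect_eq)
  then show ?thesis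
    unfolding with_copies_def restriction_def copies_def Y[symmetric] by (simp add: Y)
qed

text \<open>Every element of \<open>T\<close> has a single copy, so bases of
  \<open>T \<times> {0}\<close> are exactly the lifts of bases of \<open>T\<close>. Contracting
  before or after copying the other elements therefore gives the same matroid.\<close>

lemma contraction_copies:
  assumes M: "is_matroid M" and T: "T \<subseteq> ground M" "\<And>x. x \<in> T \<Longrightarrow> g x = 1"
  shows "contraction (copies M g) (T \<times> {0}) = copies (contraction M T) g"
proof -
  let ?G = "SIGMA x:ground M. {..<g x}"
  let ?H = "SIGMA x:ground M - T. {..<g x}"
  let ?c = "\<lambda>B. (\<lambda>x. (x, 0::nat)) ` B"
  have G: "?G - T \<times> {0} = ?H" using T by auto
  have T0: "T \<times> {0} \<subseteq> ?G" using T by auto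
  have indep_c: "?c B \<in> indeps (copies M g) \<longleftrightarrow> B \<in> indeps M" if "B \<subseteq> T" for B
    using that T by (auto simp: copies_def image_image inj_on_def)
  have basis: "basis_of (copies M g) (T \<times> {0}) B' \<longleftrightarrow> (\<exists>B. B' = ?c B \<and> basis_of M T B)" for B'
  proof
    assume B': "basis_of (copies M g) (T \<times> {0}) B'"
    then have "B' \<subseteq> T \<times> {0}" by (simp add: basis_of_def)
    then have eq: "?c (fst ` B') = B'" and sub: "fst ` B' \<subseteq> T" by force+
    have "C = fst ` B'" if "C \<in> indeps M" "fst ` B' \<subseteq> C" "C \<subseteq> T" for C
    proof -
      have "?c C \<in> indeps (copies M g)" using that indep_c by simp
      moreover have "B' \<subseteq> ?c C" using eq that(2) by (metis image_mono)
      moreover have "?c C \<subseteq> T \<times> {0}" using that by auto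
      ultimately have "?c C = B'" using B' unfolding basis_of_def by blast
      then have "fst ` ?c C = fst ` B'" by simp
      then show ?thesis by (simp add: image_image)
    qed
    moreover have "fst ` B' \<in> indeps M"
      using B' indep_c[OF sub] unfolding eq basis_of_def by blast
    ultimately have "basis_of M T (fst ` B')" using sub unfolding basis_of_def by blast
    then show "\<exists>B. B' = ?c B \<and> basis_of M T B" using eq by metis
  next
    assume "\<exists>B. B' = ?c B \<and> basis_of M T B"
    then obtain B where B: "B' = ?c B" "basis_of M T B" by blast
    have "C' = B'" if "C' \<in> indeps (copies M g)" "B' \<subseteq> C'" "C' \<subseteq> T \<times> {0}" for C'
    proof -
      have eq: "?c (fst ` C') = C'" and sub: "fst ` C' \<subseteq> T" using that(3) by force+
      have "fst ` C' \<in> indeps M" using that(1) indep_c[OF sub] unfolding eq by blast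
      moreover have "B \<subseteq> fst ` C'" using image_mono[OF that(2), of fst] B(1) by (simp add: image_image)
      ultimately have "fst ` C' = B" using B(2) sub unfolding basis_of_def by blast
      then show ?thesis using B(1) eq by metis
    qed
    moreover have "B \<in> indeps M" "B \<subseteq> T" using B(2) by (auto simp: basis_of_def)
    ultimately show "basis_of (copies M g) (T \<times> {0}) B'"
      using B(1) indep_c[of B] unfolding basis_of_def by auto
  qed
  have "J \<union> ?c B \<in> indeps (copies M g) \<longleftrightarrow> inj_on fst J \<and> fst ` J \<union> B \<in> indeps M"
    if J: "J \<subseteq> ?H" and B: "B \<subseteq> T" for J B
  proof -
    have "?c B \<subseteq> T \<times> {0}" using B by auto
    then have "J \<union> ?c B \<subseteq> ?G" using J T0 by blast
    moreover have "fst ` (J \<union> ?c B) = fst ` J \<union> B" by (simp add: image_Un image_image)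
    \<comment> \<open>First components of \<open>J\<close> avoid \<open>T\<close>, so a lifted basis
      inside \<open>T\<close> cannot repeat any of them.\<close>
    moreover have "inj_on fst (J \<union> ?c B) \<longleftrightarrow> inj_on fst J"
    proof
      assume "inj_on fst J"
      moreover have "x \<notin> B" if "(x, i) \<in> J" for x i using that J B by auto
      ultimately show "inj_on fst (J \<union> ?c B)"
        by (auto simp: inj_on_Un inj_on_def)
    qed (auto simp: inj_on_Un)
    ultimately show ?thesis by (simp add: copies_def)
  qed
  moreover have "fst ` J \<subseteq> ground M - T" if "J \<subseteq> ?H" for J using that by auto
  moreover have "B \<subseteq> T" if "basis_of M T B" for B using that by (simp add: basis_of_def)
  ultimately have "J \<subseteq> ?H \<and> (\<exists>B'. basis_of (copies M g) (T \<times> {0}) B' \<and> J \<union> B' \<in> indeps (copies M g)) \<longleftrightarrow>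
      J \<subseteq> ?H \<and> inj_on fst J \<and> fst ` J \<subseteq> ground M - T \<and> (\<exists>B. basis_of M T B \<and> fst ` J \<union> B \<in> indeps M)" for J
    unfolding basis by (smt (verit, best))
  moreover have "ground (copies M g) = ?G" by (simp add: copies_def)
  ultimately show ?thesis
    unfolding contraction_def by (simp add: G copies_def conj_assoc)
qed

lemma disjoint_family_on_index_unique:
  assumes "disjoint_family_on A I" "i \<in> I" "j \<in> I" "x \<in> A i" "x \<in> A j"
  shows "i = j"
  using assms unfolding disjoint_family_on_def by blast

section \<open>Ordered partitions as families with labelled copies\<close>

lemma ordered_indep_partitions_copies:
  fixes K :: "'a matroid" and g :: "'a \<Rightarrow> nat" and p :: nat
  defines "S \<equiv> \<lambda>D x. {s \<in> {1..p}. x \<in> D s}"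
  assumes K: "is_matroid K" and g: "\<And>x. x \<notin> ground K \<Longrightarrow> g x = 0"
  shows "bij_betw (\<lambda>(D, \<phi>). \<lambda>s\<in>{1..p}. (\<lambda>x. (x, \<phi> x s)) ` D s)
    (SIGMA D:multifamilies K p i g.
       \<Pi>\<^sub>E x\<in>ground K. {f \<in> S D x \<rightarrow>\<^sub>E {..<g x}. inj_on f (S D x)})
    (ordered_indep_partitions (copies K g) p i)"
    (is "bij_betw ?F (Sigma _ ?P) ?O")
proof -
  note KD = is_matroidD[OF K]
  have "inj_on ?F (Sigma (multifamilies K p i g) ?P)"
  proof (rule inj_onI)
    fix a a' assume a: "a \<in> Sigma (multifamilies K p i g) ?P"
      and a': "a' \<in> Sigma (multifamilies K p i g) ?P" and eq: "?F a = ?F a'"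
    obtain D \<phi> D' \<phi>' where aa: "a = (D, \<phi>)" "a' = (D', \<phi>')" by fastforce
    have img: "(\<lambda>x. (x, \<phi> x s)) ` D s = (\<lambda>x. (x, \<phi>' x s)) ` D' s" if "s \<in> {1..p}" for s
      using fun_cong[OF eq, of s] that by (simp add: aa)
    have DD: "D s = D' s" if "s \<in> {1..p}" for s
      using arg_cong[OF img[OF that], of "\<lambda>A. fst ` A"] by (simp add: image_image)
    have "D \<in> extensional {1..p}" "D' \<in> extensional {1..p}"
      using a a' aa by (auto simp: multifamilies_def PiE_def)
    then have D: "D = D'" using DD by (rule extensionalityI)
    have "\<phi> x s = \<phi>' x s" if "s \<in> {1..p}" "x \<in> D s" for x s
      using img[OF that(1)] that(2) by auto
    then have eqS: "\<phi> x s = \<phi>' x s" if "s \<in> S D x" for x s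
      using that by (simp add: S_def)
    have \<phi>: "\<phi> \<in> ?P D" "\<phi>' \<in> ?P D" using a a' aa D by auto
    \<comment> \<open>The images determine labels only on \<open>S D x\<close>; extensionality,
      first there and then over the ground set, gives equality of the functions.\<close>
    have "\<phi> x = \<phi>' x" if "x \<in> ground K" for x
    proof (rule extensionalityI)
      show "\<phi> x \<in> extensional (S D x)" "\<phi>' x \<in> extensional (S D x)"
        using PiE_mem[OF \<phi>(1) that] PiE_mem[OF \<phi>(2) that] by (auto simp: PiE_def)
    qed (rule eqS)
    then have "\<phi> = \<phi>'" using \<phi> by (intro PiE_ext[of \<phi> "ground K" _ \<phi>'])
    then show "a = a'" using aa D by simp
  qed
  moreover have "?F ` Sigma (multifamilies K p i g) ?P \<subseteq> ?O"
  proof (clarify, goal_cases)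
    case (1 _ D \<phi>)
    let ?A = "\<lambda>s\<in>{1..p}. (\<lambda>x. (x, \<phi> x s)) ` D s"
    have D: "D s \<in> indeps K" "int (card (D s)) = i s" if "s \<in> {1..p}" for s
      using 1(1) that by (auto simp: multifamilies_def)
    have Dx: "x \<in> ground K" if "s \<in> {1..p}" "x \<in> D s" for s x
      using D(1)[OF that(1)] KD(2) that(2) by blast
    have cS: "card (S D x) = g x" for x
      using 1(1) by (simp add: multifamilies_def S_def)
    have \<phi>: "\<phi> x \<in> S D x \<rightarrow> {..<g x}" "inj_on (\<phi> x) (S D x)" if "x \<in> ground K" for x
      using PiE_mem[OF 1(2) that] by auto
    \<comment> \<open>The number of members containing \<open>x\<close> is \<open>g x\<close>, so an
      injective labelling uses every copy.\<close>
    have onto: "\<phi> x ` S D x = {..<g x}" if "x \<in> ground K" for x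
      using \<phi>[OF that] cS[of x] by (intro card_subset_eq) (auto simp: card_image)
    have sub: "?A s \<subseteq> ground (copies K g)" if s: "s \<in> {1..p}" for s
      using s Dx[OF s] \<phi>(1) by (fastforce simp: S_def copies_def)
    have "?A s \<in> indeps (copies K g)" if s: "s \<in> {1..p}" for s
      using s sub[OF s] D(1)[OF s] by (simp add: copies_def inj_on_def image_image)
    moreover have "disjoint_family_on ?A {1..p}"
    proof (unfold disjoint_family_on_def, intro ballI impI equals0I)
      fix s t y assume st: "s \<in> {1..p}" "t \<in> {1..p}" "s \<noteq> t" and "y \<in> ?A s \<inter> ?A t"
      then obtain x where x: "x \<in> D s" "x \<in> D t" "\<phi> x s = \<phi> x t" by auto
      then have "s = t"
        using \<phi>(2)[OF Dx[OF st(1) x(1)]] st by (auto simp: inj_on_def S_def)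
      then show False using st by simp
    qed
    moreover have "(\<Union>s\<in>{1..p}. ?A s) = ground (copies K g)"
    proof
      show "(\<Union>s\<in>{1..p}. ?A s) \<subseteq> ground (copies K g)"
        using sub by (rule UN_least)
      show "ground (copies K g) \<subseteq> (\<Union>s\<in>{1..p}. ?A s)"
      proof
        fix y assume "y \<in> ground (copies K g)"
        then obtain x j where y: "y = (x, j)" "x \<in> ground K" "j < g x" by (auto simp: copies_def)
        then obtain s where "s \<in> S D x" "j = \<phi> x s" using onto[of x] by blast
        then show "y \<in> (\<Union>s\<in>{1..p}. ?A s)" using y by (auto simp: S_def)
      qed
    qed
    moreover have "int (card (?A s)) = i s" if "s \<in> {1..p}" for s
      using that D(2)[OF that] by (simp add: card_image inj_on_def)
    ultimately show ?case unfolding ordered_indep_partitions_def by auto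
  qed
  moreover have "A \<in> ?F ` Sigma (multifamilies K p i g) ?P" if A: "A \<in> ?O" for A
  proof -
    define D where "D = (\<lambda>s\<in>{1..p}. fst ` A s)"
    \<comment> \<open>The choice is unique: an independent set contains at most one copy of
      \<open>x\<close>, which \<open>\<phi>eq\<close> exploits.\<close>
    define \<phi> where "\<phi> = (\<lambda>x\<in>ground K. \<lambda>s\<in>S D x. SOME j. (x, j) \<in> A s)"
    have As: "A s \<subseteq> (SIGMA x:ground K. {..<g x})" "inj_on fst (A s)" "fst ` A s \<in> indeps K"
      "int (card (A s)) = i s" if "s \<in> {1..p}" for s
      using A that by (auto simp: ordered_indep_partitions_def copies_def PiE_iff)
    have disj: "disjoint_family_on A {1..p}"
      and un: "(\<Union>s\<in>{1..p}. A s) = (SIGMA x:ground K. {..<g x})"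
      using A by (auto simp: ordered_indep_partitions_def copies_def)
    have \<phi>A: "(x, \<phi> x s) \<in> A s" if "s \<in> S D x" for x s
    proof -
      have s: "s \<in> {1..p}" "x \<in> fst ` A s" using that by (auto simp: S_def D_def)
      then have "\<exists>j. (x, j) \<in> A s" by force
      moreover have "x \<in> ground K" using s As(1)[OF s(1)] by auto
      ultimately show ?thesis using that someI_ex[of "\<lambda>j. (x, j) \<in> A s"] by (simp add: \<phi>_def)
    qed
    have \<phi>eq: "j = \<phi> x s" "s \<in> S D x" if "s \<in> {1..p}" "(x, j) \<in> A s" for x j s
    proof -
      show s: "s \<in> S D x" using that by (force simp: S_def D_def)
      show "j = \<phi> x s" using inj_onD[OF As(2)[OF that(1)] _ that(2) \<phi>A[OF s]] by simp
    qed
    have bij: "bij_betw (\<phi> x) (S D x) {..<g x}" if x: "x \<in> ground K" for x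
    proof (rule bij_betw_imageI)
      show "inj_on (\<phi> x) (S D x)"
      proof (rule inj_onI)
        fix s t assume st: "s \<in> S D x" "t \<in> S D x" "\<phi> x s = \<phi> x t"
        then have "(x, \<phi> x s) \<in> A s \<inter> A t" using \<phi>A[of s x] \<phi>A[of t x] by simp
        then show "s = t"
          using disj st unfolding disjoint_family_on_def S_def by blast
      qed
      show "\<phi> x ` S D x = {..<g x}"
      proof
        show "\<phi> x ` S D x \<subseteq> {..<g x}"
          using \<phi>A As(1) by (fastforce simp: S_def)
        show "{..<g x} \<subseteq> \<phi> x ` S D x"
        proof
          fix j assume "j \<in> {..<g x}"
          then have "(x, j) \<in> (\<Union>s\<in>{1..p}. A s)" using x un by blast
          then show "j \<in> \<phi> x ` S D x" using \<phi>eq by blast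
        qed
      qed
    qed
    have "card (S D x) = g x" for x
    proof (cases "x \<in> ground K")
      case True
      then show ?thesis using bij_betw_same_card[OF bij] by simp
    next
      case False
      then have "S D x = {}" using As(1) by (fastforce simp: S_def D_def)
      then show ?thesis using g[OF False] by simp
    qed
    then have "D \<in> multifamilies K p i g"
      using As by (auto simp: multifamilies_def S_def D_def card_image)
    moreover have "\<phi> \<in> ?P D"
    proof -
      have "\<phi> x \<in> extensional (S D x)" if "x \<in> ground K" for x
        using that by (simp add: \<phi>_def)
      then show ?thesis
        using bij by (auto simp: PiE_def bij_betw_def \<phi>_def)
    qed
    moreover have "A = ?F (D, \<phi>)"
    proof (rule extensionalityI[of _ "{1..p}"])
      show "A \<in> extensional {1..p}" using A by (auto simp: ordered_indep_partitions_def PiE_def)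
      show "?F (D, \<phi>) \<in> extensional {1..p}" by simp
      fix s assume s: "s \<in> {1..p}"
      have "A s = (\<lambda>x. (x, \<phi> x s)) ` D s"
      proof
        show "A s \<subseteq> (\<lambda>x. (x, \<phi> x s)) ` D s"
          using \<phi>eq(1)[OF s] s by (force simp: D_def)
        show "(\<lambda>x. (x, \<phi> x s)) ` D s \<subseteq> A s"
          using \<phi>A s by (auto simp: S_def)
      qed
      then show "A s = ?F (D, \<phi>) s" using s by simp
    qed
    ultimately show ?thesis by (intro image_eqI[of _ _ "(D, \<phi>)"]) auto
  qed
  ultimately show ?thesis unfolding bij_betw_def by blast
qed

text \<open>All families have the same number of labellings, since that number depends on the
  multiplicities alone. The factor is thus independent of the block sizes \<open>i\<close>.\<close>

lemma num_partitions_copies: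
  assumes K: "is_matroid K" and g: "\<And>x. x \<notin> ground K \<Longrightarrow> g x = 0"
  shows "num_partitions (copies K g) p i = card (multifamilies K p i g) * (\<Prod>x\<in>ground K. fact (g x))"
proof -
  let ?P = "\<lambda>D. \<Pi>\<^sub>E x\<in>ground K. {f \<in> {s \<in> {1..p}. x \<in> D s} \<rightarrow>\<^sub>E {..<g x}. inj_on f {s \<in> {1..p}. x \<in> D s}}"
  have P: "finite (?P D) \<and> card (?P D) = (\<Prod>x\<in>ground K. fact (g x))" if "D \<in> multifamilies K p i g" for D
  proof -
    have "card {f \<in> {s \<in> {1..p}. x \<in> D s} \<rightarrow>\<^sub>E {..<g x}. inj_on f {s \<in> {1..p}. x \<in> D s}} = fact (g x)" for x
      using that by (subst card_inj_funcset) (auto simp: multifamilies_def)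
    then show ?thesis
      using is_matroidD(1)[OF K] by (simp add: card_PiE finite_PiE)
  qed
  have "num_partitions (copies K g) p i = card (Sigma (multifamilies K p i g) ?P)"
    unfolding num_partitions_def
    by (rule bij_betw_same_card[OF ordered_indep_partitions_copies[OF K g], symmetric])
  also have "\<dots> = (\<Sum>D\<in>multifamilies K p i g. card (?P D))"
    using finite_multifamilies[OF K] P by (intro card_SigmaI) blast+
  also have "\<dots> = card (multifamilies K p i g) * (\<Prod>x\<in>ground K. fact (g x))"
    using P by simp
  finally show ?thesis .
qed

section \<open>Contraction and elements of exponent \<open>p\<close>\<close>

lemma indeps_contraction_iff:
  assumes M: "is_matroid M" and B: "basis_of M T B"
  shows "J \<in> indeps (contraction M T) \<longleftrightarrow> J \<inter> T = {} \<and> J \<union> B \<in> indeps M"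
  using contraction_basis_indep[OF M _ B, of _ J] B is_matroidD(2)[OF M]
  unfolding contraction_def by auto

text \<open>Adding \<open>B\<close> to every member of a family of the contraction gives a family of
  \<open>M\<close>, with sizes raised by \<open>card B\<close>; removing \<open>B\<close> is the
  inverse.\<close>

lemma card_multifamilies_contraction:
  assumes M: "is_matroid M" and B: "basis_of M T B" and g: "\<And>x. x \<in> T \<Longrightarrow> g x = 0"
  shows "card (multifamilies (contraction M T) p i g) =
    card (multifamilies M p (\<lambda>s. i s + int (card B)) (\<lambda>x. if x \<in> B then p else g x))"
    (is "card ?L = card ?R")
proof (rule bij_betw_same_card)
  have BT: "B \<subseteq> T" and finB: "finite B"
    using B is_matroidD(6)[OF M] by (auto simp: basis_of_def)
  note iff = indeps_contraction_iff[OF M B]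
  \<comment> \<open>Exponent \<open>p\<close> forces elements of \<open>B\<close> into all
    \<open>p\<close> members, and exponent 0 keeps the rest of \<open>T\<close> out of all of
    them.\<close>
  have meet: "I s \<inter> T = B" if I: "I \<in> ?R" and s: "s \<in> {1..p}" for I s
  proof -
    have count: "card {s \<in> {1..p}. x \<in> I s} = (if x \<in> B then p else g x)" for x
      using I by (auto simp: multifamilies_def)
    have "x \<in> I s" if "x \<in> B" for x
    proof -
      have "{s \<in> {1..p}. x \<in> I s} = {1..p}"
        using count[of x] that by (intro card_subset_eq) auto
      then show ?thesis using s by blast
    qed
    moreover have "x \<in> B" if "x \<in> I s" "x \<in> T" for x
    proof (rule ccontr)
      assume "x \<notin> B"
      then have "{s \<in> {1..p}. x \<in> I s} = {}" using count[of x] g[OF that(2)] by simp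
      then show False using s that(1) by blast
    qed
    ultimately show ?thesis using BT by blast
  qed
  show "bij_betw (\<lambda>D. \<lambda>s\<in>{1..p}. D s \<union> B) ?L ?R"
  proof (rule bij_betw_byWitness[where f' = "\<lambda>I. \<lambda>s\<in>{1..p}. I s - B"])
    have disj: "D s \<inter> B = {}" if "D \<in> ?L" "s \<in> {1..p}" for D s
      using that BT iff[of "D s"] by (auto simp: multifamilies_def)
    show "\<forall>D\<in>?L. (\<lambda>s\<in>{1..p}. (\<lambda>s\<in>{1..p}. D s \<union> B) s - B) = D"
    proof
      fix D assume D: "D \<in> ?L"
      have "D \<in> extensional {1..p}" using D by (auto simp: multifamilies_def PiE_def)
      then show "(\<lambda>s\<in>{1..p}. (\<lambda>s\<in>{1..p}. D s \<union> B) s - B) = D"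
        using disj[OF D] by (intro extensionalityI[of _ "{1..p}"]) auto
    qed
    show "\<forall>I\<in>?R. (\<lambda>s\<in>{1..p}. (\<lambda>s\<in>{1..p}. I s - B) s \<union> B) = I"
    proof
      fix I assume I: "I \<in> ?R"
      have "I \<in> extensional {1..p}" using I by (auto simp: multifamilies_def PiE_def)
      then show "(\<lambda>s\<in>{1..p}. (\<lambda>s\<in>{1..p}. I s - B) s \<union> B) = I"
        using meet[OF I] by (intro extensionalityI[of _ "{1..p}"]) auto
    qed
    show "(\<lambda>D. \<lambda>s\<in>{1..p}. D s \<union> B) ` ?L \<subseteq> ?R"
    proof (rule image_subsetI)
      fix D assume D: "D \<in> ?L"
      have ind: "D s \<union> B \<in> indeps M" if "s \<in> {1..p}" for s
        using D that iff[of "D s"] by (auto simp: multifamilies_def)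
      have "card (D s \<union> B) = card (D s) + card B" if "s \<in> {1..p}" for s
        using disj[OF D that] is_matroidD(6)[OF M ind[OF that]] by (intro card_Un_disjoint) auto
      moreover have "card {s \<in> {1..p}. x \<in> D s \<union> B} = (if x \<in> B then p else g x)" for x
      proof (cases "x \<in> B")
        case True
        then have "{s \<in> {1..p}. x \<in> D s \<union> B} = {1..p}" by auto
        then show ?thesis using True by simp
      next
        case False
        then show ?thesis using D by (simp add: multifamilies_def)
      qed
      ultimately show "(\<lambda>s\<in>{1..p}. D s \<union> B) \<in> ?R"
        using D ind by (auto simp: multifamilies_def cong: conj_cong)
    qed
    show "(\<lambda>I. \<lambda>s\<in>{1..p}. I s - B) ` ?R \<subseteq> ?L"
    proof (rule image_subsetI)
      fix I assume I: "I \<in> ?R"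
      have sub: "B \<subseteq> I s" if "s \<in> {1..p}" for s using meet[OF I that] by blast
      have "I s - B \<in> indeps (contraction M T)" if "s \<in> {1..p}" for s
      proof -
        have "I s - B \<union> B = I s" using sub[OF that] by blast
        moreover have "I s \<in> indeps M" using I that by (auto simp: multifamilies_def)
        ultimately show ?thesis using meet[OF I that] unfolding iff by auto
      qed
      moreover have "int (card (I s - B)) = i s" if "s \<in> {1..p}" for s
      proof -
        have "I s \<in> indeps M" "int (card (I s)) = i s + int (card B)"
          using I that by (auto simp: multifamilies_def)
        moreover from this(1) have "finite (I s)" by (rule is_matroidD(6)[OF M])
        ultimately show ?thesis
          using sub[OF that] finB card_mono[of "I s" B] by (simp add: card_Diff_subset of_nat_diff)
      qed
      moreover have "card {s \<in> {1..p}. x \<in> I s - B} = g x" for x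
        using I BT g[of x] by (cases "x \<in> B") (auto simp: multifamilies_def)
      ultimately show "(\<lambda>s\<in>{1..p}. I s - B) \<in> ?L"
        by (auto simp: multifamilies_def cong: conj_cong)
    qed
  qed
qed

section \<open>Partition numbers of the minors as multiples of coefficients\<close>

lemma minor_Xq_eq_copies:
  assumes M: "is_matroid M" and p: "p \<ge> 1" and X: "\<And>s. s \<in> {1..p} \<Longrightarrow> X s \<subseteq> ground M"
    and disj: "disjoint_family_on X {1..p}"
    and e: "\<And>s x. s \<in> {1..<p} \<Longrightarrow> x \<in> X s \<Longrightarrow> e x = q s"
      "\<And>x. x \<notin> (\<Union>s\<in>{1..<p}. X s) \<Longrightarrow> e x = 0"
  shows "minor_Xq M p X q = copies (contraction M (X p)) e"
proof -
  let ?U = "\<Union>s\<in>{1..p}. X s"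
  \<comment> \<open>Multiplicities after the classes with index below \<open>t\<close> have been
    extended: final on those classes, 1 on the others, 0 outside their union.\<close>
  let ?g = "\<lambda>t x. if x \<in> (\<Union>s\<in>{1..<t}. X s) then e x else if x \<in> ?U then 1 else 0"
  have fold: "foldl (\<lambda>N s. par_ext N (X s) (q s)) (with_copies (restriction M ?U)) [1..<t] =
      copies M (?g t)" if "t \<le> p" for t
    using that
  proof (induction t)
    case 0
    then show ?case by (simp add: with_copies_restriction[OF M])
  next
    case (Suc t)
    show ?case
    \<comment> \<open>Indices start at 1, so going from \<open>t = 0\<close> to 1 leaves the list
      empty and extends nothing.\<close>
    proof (cases "t = 0")
      case True
      then show ?thesis by (simp add: with_copies_restriction[OF M])
    next
      case False
      have "?g t x > 0" if "x \<in> X t" for x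
      proof -
        have "x \<notin> X s" if "s \<in> {1..<t}" for s
          using disjoint_family_on_index_unique[OF disj, of s t x] \<open>x \<in> X t\<close> that Suc.prems by auto
        moreover have "x \<in> ?U" using that Suc.prems False by (intro UN_I[of t]) auto
        ultimately show ?thesis by simp
      qed
      then have "par_ext (copies M (?g t)) (X t) (q t) =
          copies M (\<lambda>x. if x \<in> X t then q t else ?g t x)"
        using X[of t] Suc.prems False by (intro par_ext_copies) auto
      also have "(\<lambda>x. if x \<in> X t then q t else ?g t x) = ?g (Suc t)"
        using e(1)[of t] Suc.prems False by (auto simp: fun_eq_iff atLeastLessThanSuc)
      finally show ?thesis using Suc False by simp
    qed
  qed
  have Xp: "x \<notin> X s" if "x \<in> X p" "s \<in> {1..<p}" for x s
    using disjoint_family_on_index_unique[OF disj, of s p x] that p by auto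
  have "minor_Xq M p X q = contraction (copies M (?g p)) (X p \<times> {0})"
    unfolding minor_Xq_def using fold[of p] by simp
  also have "\<dots> = copies (contraction M (X p)) (?g p)"
  proof (intro contraction_copies[OF M])
    show "X p \<subseteq> ground M" using X[of p] p by simp
    show "?g p x = 1" if "x \<in> X p" for x
      using Xp[OF that] that p by auto
  qed
  \<comment> \<open>The two multiplicity functions differ only on \<open>X p\<close>, which the
    contraction has removed.\<close>
  also have "\<dots> = copies (contraction M (X p)) e"
  proof (rule copies_cong)
    fix x assume "x \<in> ground (contraction M (X p))"
    then have "x \<notin> X p" by (simp add: contraction_def)
    moreover have "{1..p} = insert p {1..<p}" using p by auto
    ultimately show "?g p x = e x" using e(2)[of x] by auto
  qed
  finally show ?thesis .
qed

lemma mrank_eq_card_basis: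
  assumes M: "is_matroid M" and B: "basis_of M T B"
  shows "mrank M T = card B"
  unfolding mrank_def
  using B basis_card_le[OF M B] finite_indeps[OF M]
  by (intro Max_eqI) (auto simp: basis_of_def)

text \<open>The contraction shifts the block sizes by the depth, so \<open>k + n_s\<close> in a
  minor of depth \<open>l - k\<close> becomes \<open>l + n_s\<close> in \<open>M\<close>.\<close>

lemma num_partitions_minor_Xq:
  assumes M: "is_matroid M" and p: "p \<ge> 1" and X: "\<And>s. s \<in> {1..p} \<Longrightarrow> X s \<subseteq> ground M"
    and disj: "disjoint_family_on X {1..p}" and B: "basis_of M (X p) B"
    and e: "\<And>s x. s \<in> {1..<p} \<Longrightarrow> x \<in> X s \<Longrightarrow> e x = q s"
      "\<And>x. x \<notin> (\<Union>s\<in>{1..<p}. X s) \<Longrightarrow> e x = 0"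
  shows "num_partitions (minor_Xq M p X q) p i =
    card (multifamilies M p (\<lambda>s. i s + int (mrank M (X p))) (\<lambda>x. if x \<in> B then p else e x)) *
    (\<Prod>x\<in>ground M - X p. fact (e x))"
proof -
  have Xp: "e x = 0" if "x \<in> X p" for x
    using disjoint_family_on_index_unique[OF disj, of _ p x] that p by (intro e(2)) force
  have "e x = 0" if "x \<notin> ground (contraction M (X p))" for x
  proof (cases "x \<in> X p")
    case False
    then have "x \<notin> ground M" using that by (simp add: contraction_def)
    then have "x \<notin> X s" if "s \<in> {1..<p}" for s using X[of s] that by auto
    then show ?thesis by (intro e(2)) blast
  qed (rule Xp)
  then have "num_partitions (copies (contraction M (X p)) e) p i =
      card (multifamilies (contraction M (X p)) p i e) * (\<Prod>x\<in>ground M - X p. fact (e x))"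
    using num_partitions_copies[OF is_matroid_contraction[OF M]] by (simp add: contraction_def)
  moreover have "minor_Xq M p X q = copies (contraction M (X p)) e"
    by (rule minor_Xq_eq_copies[OF M p X disj e])
  moreover have "card (multifamilies (contraction M (X p)) p i e) =
      card (multifamilies M p (\<lambda>s. i s + int (card B)) (\<lambda>x. if x \<in> B then p else e x))"
    by (rule card_multifamilies_contraction[OF M B Xp])
  ultimately show ?thesis
    by (simp add: mrank_eq_card_basis[OF M B])
qed

section \<open>Equivalence of the coefficient and partition inequalities\<close>

theorem theorem4p2:
  fixes M :: "nat matroid" and n p :: nat and l :: int
    and a b :: "nat \<Rightarrow> int"
  assumes "is_matroid M" and "ground M = {1..n}"
    and "p \<ge> 2" and "l \<ge> 1"
    and "(\<Sum>s=1..p. a s) = 0" and "(\<Sum>s=1..p. b s) = 0"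
  shows "(\<Prod>s=1..p. indep_poly M (l + a s)) \<succeq>\<^sub>c (\<Prod>s=1..p. indep_poly M (l + b s))
    \<longleftrightarrow>
    (\<forall>k X. k \<le> l \<longrightarrow>
       (\<forall>s\<in>{1..p}. X s \<subseteq> ground M) \<longrightarrow>
       disjoint_family_on X {1..p} \<longrightarrow>
       int (card (ground (minor_Xq M p X (\<lambda>s. s)))) = int p * k \<longrightarrow>
       int (mrank M (X p)) = l - k \<longrightarrow>
       num_partitions (minor_Xq M p X (\<lambda>s. s)) p (\<lambda>s. k + a s)
         \<ge> num_partitions (minor_Xq M p X (\<lambda>s. s)) p (\<lambda>s. k + b s))"
    (is "?poly \<longleftrightarrow> ?part")
proof -
  note M = \<open>is_matroid M\<close>
  have p: "p \<ge> 1" using \<open>p \<ge> 2\<close> by simp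
  let ?c = "\<lambda>i e. card (multifamilies M p (\<lambda>s. l + i s) e)"
  have poly: "?poly \<longleftrightarrow> (\<forall>m. ?c b (Poly_Mapping.lookup m) \<le> ?c a (Poly_Mapping.lookup m))"
    by (simp add: coeff_ge_def lookup_minus lookup_prod_indep_poly[OF M] del: One_nat_def)
  show ?thesis
  proof
    assume ?poly
    show ?part
    proof (intro allI impI)
      fix k X
      assume X: "\<forall>s\<in>{1..p}. X s \<subseteq> ground M" and disj: "disjoint_family_on X {1..p}"
        and rank: "int (mrank M (X p)) = l - k"
      obtain B where B: "basis_of M (X p) B" using ex_basis_of[OF M] by blast
      \<comment> \<open>By disjointness the sum has at most one term, so it reads off the index of
        the class containing \<open>x\<close> and defaults to 0.\<close>
      define e where "e = (\<lambda>x. \<Sum>s | s \<in> {1..<p} \<and> x \<in> X s. s)"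
      have e1: "e x = s" if "s \<in> {1..<p}" "x \<in> X s" for s x
      proof -
        have "{s. s \<in> {1..<p} \<and> x \<in> X s} = {s}"
          using disjoint_family_on_index_unique[OF disj, of _ s x] that by auto
        then show ?thesis by (simp add: e_def)
      qed
      have e0: "e x = 0" if "x \<notin> (\<Union>s\<in>{1..<p}. X s)" for x
        using that by (auto simp: e_def)
      let ?e = "\<lambda>x. if x \<in> B then p else e x"
      \<comment> \<open>Finite support makes \<open>?e\<close> the exponent vector of an actual
        monomial, to which the coefficient inequality applies.\<close>
      have "{x. ?e x \<noteq> 0} \<subseteq> ground M"
      proof
        fix x assume "x \<in> {x. ?e x \<noteq> 0}"
        then have "x \<in> B \<or> x \<in> (\<Union>s\<in>{1..<p}. X s)" using e0[of x] by (auto split: if_splits)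
        then show "x \<in> ground M" using X B p by (fastforce simp: basis_of_def)
      qed
      then have "finite {x. ?e x \<noteq> 0}" using is_matroidD(1)[OF M] finite_subset by blast
      then have "Poly_Mapping.lookup (Abs_poly_mapping ?e) = ?e"
        by (simp add: Abs_poly_mapping_inverse)
      then have "?c b ?e \<le> ?c a ?e" using \<open>?poly\<close> unfolding poly by metis
      moreover have "num_partitions (minor_Xq M p X (\<lambda>s. s)) p (\<lambda>s. k + i s) =
          ?c i ?e * (\<Prod>x\<in>ground M - X p. fact (e x))" for i
        using num_partitions_minor_Xq[OF M p _ disj B, where e = e and q = "\<lambda>s. s" and i = "\<lambda>s. k + i s"] e1 e0 X rank
        by (simp add: algebra_simps)
      ultimately show "num_partitions (minor_Xq M p X (\<lambda>s. s)) p (\<lambda>s. k + b s)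
          \<le> num_partitions (minor_Xq M p X (\<lambda>s. s)) p (\<lambda>s. k + a s)"
        by simp
    qed
  next
    assume part: ?part
    show ?poly
      unfolding poly
    proof
      fix m :: "nat \<Rightarrow>\<^sub>0 nat"
      let ?m = "Poly_Mapping.lookup m"
      show "?c b ?m \<le> ?c a ?m"
      proof (cases "multifamilies M p (\<lambda>s. l + b s) ?m = {}")
        \<comment> \<open>If no tuple is counted on the \<open>b\<close> side, the inequality is
          trivial. Otherwise one such tuple \<open>I\<close> supplies what the minor built from
          \<open>m\<close> must satisfy: exponents at most \<open>p\<close>, support in the ground
          set, \<open>X p\<close> independent, and the right size.\<close>
        case False
        then obtain I where I: "I \<in> {1..p} \<rightarrow>\<^sub>E indeps M"
          "\<And>s. s \<in> {1..p} \<Longrightarrow> int (card (I s)) = l + b s"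
          "\<And>x. card {s \<in> {1..p}. x \<in> I s} = ?m x"
          unfolding multifamilies_def by blast
        define X where "X = (\<lambda>s. {x. ?m x = s})"
        define k where "k = l - int (card (X p))"
        \<comment> \<open>Exponent \<open>p\<close> is reset to 0 because \<open>X p\<close> is
          contracted rather than copied; \<open>em\<close> restores it.\<close>
        define e where "e = (\<lambda>x. if ?m x < p then ?m x else 0)"
        have sub: "I s \<subseteq> ground M" if "s \<in> {1..p}" for s
          using I(1) that is_matroidD(2)[OF M] by (meson PiE_mem)
        have mle: "?m x \<le> p" for x
        proof -
          have "card {s \<in> {1..p}. x \<in> I s} \<le> card {1..p}" by (rule card_mono) auto
          then show ?thesis by (simp only: I(3) card_atLeastAtMost diff_Suc_1)
        qed
        have m0: "?m x = 0" if "x \<notin> ground M" for x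
        proof -
          have "{s \<in> {1..p}. x \<in> I s} = {}" using sub that by blast
          then show ?thesis using I(3)[of x] by (simp only: card.empty)
        qed
        have X: "X s \<subseteq> ground M" if "s \<in> {1..p}" for s
          using that m0 by (fastforce simp: X_def)
        have disj: "disjoint_family_on X {1..p}"
          by (auto simp: disjoint_family_on_def X_def)
        \<comment> \<open>An element of exponent \<open>p\<close> lies in all \<open>p\<close>
          members, in particular in the first. Hence \<open>X p\<close> is independent and its own
          basis, of size \<open>l - k\<close>.\<close>
        have "X p \<subseteq> I 1"
        proof
          fix x assume "x \<in> X p"
          then have "{s \<in> {1..p}. x \<in> I s} = {1..p}"
            by (intro card_subset_eq) (auto simp only: I(3) X_def mem_Collect_eq card_atLeastAtMost diff_Suc_1 finite_atLeastAtMost)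
          moreover have "1 \<in> {1..p}" using p by simp
          ultimately show "x \<in> I 1" by blast
        qed
        then have "X p \<in> indeps M"
          using is_matroidD(4)[OF M, of "I 1"] I(1) p by (meson PiE_mem atLeastAtMost_iff le_refl)
        then have B: "basis_of M (X p) (X p)" by (auto simp: basis_of_def)
        have rank: "int (mrank M (X p)) = l - k"
          by (simp add: mrank_eq_card_basis[OF M B] k_def)
        have e1: "e x = s" if "s \<in> {1..<p}" "x \<in> X s" for s x
          using that by (auto simp: e_def X_def)
        have e0: "e x = 0" if "x \<notin> (\<Union>s\<in>{1..<p}. X s)" for x
          using that by (auto simp: e_def X_def)
        have em: "(\<lambda>x. if x \<in> X p then p else e x) = ?m"
          using mle by (auto simp: fun_eq_iff e_def X_def le_less)
        have num: "num_partitions (minor_Xq M p X (\<lambda>s. s)) p (\<lambda>s. k + i s) =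
            ?c i ?m * (\<Prod>x\<in>ground M - X p. fact (e x))" for i
          using num_partitions_minor_Xq[OF M p X disj B, where e = e and q = "\<lambda>s. s" and i = "\<lambda>s. k + i s"] e1 e0 rank
          by (simp add: em algebra_simps)
        have fin: "finite (ground M)" using is_matroidD(1)[OF M] .
        \<comment> \<open>The exponents add up to \<open>p * l\<close>; discarding the elements of
          \<open>X p\<close>, each of exponent \<open>p\<close>, leaves
          \<open>p * (l - card (X p)) = p * k\<close>.\<close>
        have "int (card (ground (minor_Xq M p X (\<lambda>s. s)))) = (\<Sum>x\<in>ground M - X p. int (e x))"
          using fin minor_Xq_eq_copies[OF M p X disj, where e = e and q = "\<lambda>s. s"] e1 e0
          by (simp add: copies_def contraction_def)
        also have "\<dots> = (\<Sum>x\<in>ground M - X p. int (?m x))"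
        proof (intro sum.cong refl arg_cong[of _ _ int])
          fix x assume "x \<in> ground M - X p"
          then show "e x = ?m x" using fun_cong[OF em, of x] by simp
        qed
        also have "\<dots> = (\<Sum>x\<in>ground M. int (?m x)) - (\<Sum>x\<in>X p. int (?m x))"
          using fin X p by (intro sum_diff) auto
        also have "(\<Sum>x\<in>X p. int (?m x)) = int p * int (card (X p))"
          by (simp add: X_def)
        \<comment> \<open>Double counting of the pairs \<open>(s, x)\<close> with
          \<open>x \<in> I s\<close>; the sizes then sum to \<open>p * l\<close> because the
          \<open>b s\<close> sum to 0.\<close>
        also have "(\<Sum>x\<in>ground M. int (?m x)) = (\<Sum>s=1..p. int (card (I s)))"
        proof -
          have "(\<Sum>s=1..p. card {x \<in> ground M. x \<in> I s}) = (\<Sum>x\<in>ground M. ?m x)"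
            using I(3) fin by (intro sum_multicount_gen) auto
          moreover have "{x \<in> ground M. x \<in> I s} = I s" if "s \<in> {1..p}" for s
            using sub[OF that] by blast
          ultimately have "(\<Sum>s=1..p. card (I s)) = (\<Sum>x\<in>ground M. ?m x)" by simp
          then show ?thesis by (simp flip: of_nat_sum)
        qed
        also have "\<dots> = int p * l"
          using I(2) assms(6) by (simp add: sum.distrib)
        finally have size: "int (card (ground (minor_Xq M p X (\<lambda>s. s)))) = int p * k"
          by (simp add: k_def algebra_simps)
        have "k \<le> l" by (simp add: k_def)
        then have "?c b ?m * (\<Prod>x\<in>ground M - X p. fact (e x)) \<le> ?c a ?m * (\<Prod>x\<in>ground M - X p. fact (e x))"
          using part X disj size rank unfolding num[symmetric] by blast
        \<comment> \<open>The same positive product of factorials multiplies both counts and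
          cancels.\<close>
        moreover have "(\<Prod>x\<in>ground M - X p. fact (e x) :: nat) > 0"
          by (simp add: prod_pos)
        ultimately show ?thesis by simp
      qed simp
    qed
  qed
qed

end
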